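(* Let $\mu>0$, let $a,b$ be real numbers with $b-a$ an integer $\ge 2$, and put $I=\{a+1,a+2,\dots,b-1\}$. Let $p,q,r:I\to\mathbb{R}$ with $p(t)>0$ and $r(t)>0$ for all $t\in I$. Then all eigenvalues $\lambda\in\mathbb{C}$ of the discrete fractional Sturm-Liouville equation $$\nabla_a^{\mu}\big(p(t)\,{}_b\nabla^{\mu}x(t)\big)+q(t)x(t)=\lambda r(t)x(t),\qquad t\in I,$$ are real.
   Context: An eigenvalue is a $\lambda\in\mathbb{C}$ for which the equation has a solution $x:I\to\mathbb{C}$ that is not identically zero. Notation: $\nabla x(t)=x(t)-x(t-1)$, $\Delta x(t)=x(t+1)-x(t)$, $\rho(t)=t-1$, and the rising function is $t^{\overline{\alpha}}=\Gamma(t+\alpha)/\Gamma(t)$. Let $n=\lfloor\mu\rfloor+1$. The (Riemann-Liouville) nabla left fractional difference of order $\mu$ is $$\nabla_a^{\mu}x(t)=\frac{1}{\Gamma(n-\mu)}\nabla^{n}\sum_{s=a+1}^{t}(t-\rho(s))^{\overline{n-\mu-1}}x(s),$$ where $\nabla^n$ acts in the variable $t$ and the sum is taken to be $0$ when $t\le a$. The (Riemann-Liouville) nabla right fractional difference of order $\mu$ is $${}_b\nabla^{\mu}x(t)=\frac{(-1)^n}{\Gamma(n-\mu)}\Delta^{n}\sum_{s=t}^{b-1}(s-\rho(t))^{\overline{n-\mu-1}}x(s),$$ where $\Delta^n$ acts in the variable $t$ and the sum is taken to be $0$ when $t\ge b$. For $t\in I$ both expressions depend only on the values of $x$ on $I$.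 The expression $\nabla_a^{\mu}(p(t)\,{}_b\nabla^{\mu}x(t))$ means $\nabla_a^\mu$ applied to the function $t\mapsto p(t)\cdot({}_b\nabla^\mu x)(t)$ on $I$. *)

theory Defs
  imports "HOL-Analysis.Analysis"
begin

text \<open>The points \<open>u, u + 1, u + 2, \<dots>\<close> not exceeding \<open>v\<close>. The set is empty if \<open>v < u\<close>, so sums
  over it follow the convention that \<open>\<Sum>s=a+1..t\<close> vanishes for \<open>t \<le> a\<close> and \<open>\<Sum>s=t..b-1\<close>
  vanishes for \<open>t \<ge> b\<close>.\<close>

definition unit_steps :: "real \<Rightarrow> real \<Rightarrow> real set" where
  "unit_steps u v = {s. s - u \<in> \<int> \<and> u \<le> s \<and> s \<le> v}"

lemma unit_steps_eq_image:
  "unit_steps u v = (\<lambda>k::int. u + of_int k) ` {0..\<lfloor>v - u\<rfloor>}"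
proof (intro equalityI subsetI)
  fix s assume "s \<in> unit_steps u v"
  then have s: "s - u \<in> \<int>" "u \<le> s" "s \<le> v"
    by (auto simp: unit_steps_def)
  then obtain k :: int where k: "s - u = of_int k"
    by (auto elim: Ints_cases)
  with s have "0 \<le> k" "k \<le> \<lfloor>v - u\<rfloor>"
    by (auto simp: le_floor_iff)
  moreover have "s = u + of_int k"
    using k by simp
  ultimately show "s \<in> (\<lambda>k::int. u + of_int k) ` {0..\<lfloor>v - u\<rfloor>}"
    by auto
qed (auto simp: unit_steps_def le_floor_iff)

lemma finite_unit_steps: "finite (unit_steps u v)"
  by (simp add: unit_steps_eq_image)

definition rho :: "real \<Rightarrow> real" where
  "rho t = t - 1"

definition nabla :: "(real \<Rightarrow> complex) \<Rightarrow> real \<Rightarrow> complex" where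
  "nabla x t = x t - x (t - 1)"

definition delta :: "(real \<Rightarrow> complex) \<Rightarrow> real \<Rightarrow> complex" where
  "delta x t = x (t + 1) - x t"

definition rising :: "real \<Rightarrow> real \<Rightarrow> real" where
  "rising t \<alpha> = Gamma (t + \<alpha>) / Gamma t"

definition frac_n :: "real \<Rightarrow> nat" where
  "frac_n \<mu> = nat \<lfloor>\<mu>\<rfloor> + 1"

text \<open>Riemann-Liouville nabla left and right fractional differences of order \<open>\<mu>\<close>. Functions on
  \<open>{a+1, \<dots>, b-1}\<close> are represented by total functions; at points of that set the differences
  use no values outside it.\<close>

definition nabla_left :: "real \<Rightarrow> real \<Rightarrow> (real \<Rightarrow> complex) \<Rightarrow> real \<Rightarrow> complex" where
  "nabla_left a \<mu> x t =
     complex_of_real (1 / Gamma (real (frac_n \<mu>) - \<mu>)) *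
     (nabla ^^ frac_n \<mu>)
       (\<lambda>t. \<Sum>s\<in>unit_steps (a + 1) t.
              complex_of_real (rising (t - rho s) (real (frac_n \<mu>) - \<mu> - 1)) * x s) t"

definition nabla_right :: "real \<Rightarrow> real \<Rightarrow> (real \<Rightarrow> complex) \<Rightarrow> real \<Rightarrow> complex" where
  "nabla_right b \<mu> x t =
     complex_of_real ((-1) ^ frac_n \<mu> / Gamma (real (frac_n \<mu>) - \<mu>)) *
     (delta ^^ frac_n \<mu>)
       (\<lambda>t. \<Sum>s\<in>unit_steps t (b - 1).
              complex_of_real (rising (s - rho t) (real (frac_n \<mu>) - \<mu> - 1)) * x s) t"

definition fSL_eigenvalue ::
  "real \<Rightarrow> real \<Rightarrow> real \<Rightarrow> (real \<Rightarrow> real) \<Rightarrow> (real \<Rightarrow> real) \<Rightarrow> (real \<Rightarrow> real) \<Rightarrow> complex \<Rightarrow> bool" where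
  "fSL_eigenvalue \<mu> a b p q r lam \<longleftrightarrow>
     (\<exists>x :: real \<Rightarrow> complex.
        (\<exists>t\<in>unit_steps (a + 1) (b - 1). x t \<noteq> 0) \<and>
        (\<forall>t\<in>unit_steps (a + 1) (b - 1).
           nabla_left a \<mu> (\<lambda>\<tau>. complex_of_real (p \<tau>) * nabla_right b \<mu> x \<tau>) t
             + complex_of_real (q t) * x t
           = lam * complex_of_real (r t) * x t))"

end

theory Submission
  imports Defs
begin

text \<open>Both fractional differences are given on \<open>I\<close> by real matrices with entries \<open>K (t - s)\<close> and
  \<open>K (s - t)\<close>, where \<open>K\<close> is the \<open>n\<close>-th nabla difference of the power kernel extended by zero to
  negative arguments. They are therefore transposes of each other, so pairing the equation with
  the conjugate of \<open>x\<close> turns it into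
  \<open>\<Sum>p |\<nabla>x|^2 + \<Sum>q |x|^2 = \<lambda> \<Sum>r |x|^2\<close>, \<open>\<nabla>\<close> being the right difference; here the last sum is
  positive and all sums are real.\<close>

text \<open>The argument \<open>d\<close> stands for \<open>t - s\<close>, so \<open>d + 1\<close>
  is \<open>t - rho s\<close>. The zero extension lets the sums run over a fixed index set instead
  of one that moves with \<open>t\<close>.\<close>

definition frac_kernel :: "real \<Rightarrow> real \<Rightarrow> complex" where
  "frac_kernel \<mu> d =
     (if d \<ge> 0 then complex_of_real (rising (d + 1) (real (frac_n \<mu>) - \<mu> - 1)) else 0)"

definition diff_kernel :: "real \<Rightarrow> real \<Rightarrow> complex" where
  "diff_kernel \<mu> d =
     complex_of_real (1 / Gamma (real (frac_n \<mu>) - \<mu>)) * (nabla ^^ frac_n \<mu>) (frac_kernel \<mu>) d"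

lemma nabla_funpow_Suc: "(nabla ^^ Suc n) g t = (nabla ^^ n) g t - (nabla ^^ n) g (t - 1)"
  by (simp add: nabla_def)

lemma delta_funpow_Suc: "(delta ^^ Suc n) g t = (delta ^^ n) g (t + 1) - (delta ^^ n) g t"
  by (simp add: delta_def)

lemma nabla_funpow_real:
  assumes "\<And>d. g d \<in> \<real>"
  shows "(nabla ^^ n) g d \<in> \<real>"
proof (induction n arbitrary: d)
  case (Suc n)
  show ?case
    unfolding nabla_funpow_Suc by (intro Reals_diff Suc)
qed (simp add: assms)

lemma diff_kernel_real: "diff_kernel \<mu> d \<in> \<real>"
  unfolding diff_kernel_def by (intro Reals_mult nabla_funpow_real) (auto simp: frac_kernel_def)

text \<open>Since \<open>I\<close> does not depend on \<open>t\<close>, a shift of \<open>t\<close>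
  only shifts the argument of \<open>g\<close>.\<close>

lemma nabla_funpow_convolution:
  "(nabla ^^ n) (\<lambda>t. \<Sum>s\<in>I. g (t - s) * x s) = (\<lambda>t. \<Sum>s\<in>I. (nabla ^^ n) g (t - s) * x s)"
proof (induction n)
  case (Suc n)
  show ?case
    unfolding fun_eq_iff nabla_funpow_Suc Suc by (simp add: algebra_simps sum_subtractf)
qed simp

text \<open>Moving \<open>t\<close> forward moves \<open>s - t\<close> backward, so each forward
  difference in \<open>t\<close> is minus a backward difference of \<open>g\<close>.\<close>

lemma delta_funpow_convolution:
  "(delta ^^ n) (\<lambda>t. \<Sum>s\<in>I. g (s - t) * x s) =
     (\<lambda>t. (-1) ^ n * (\<Sum>s\<in>I. (nabla ^^ n) g (s - t) * x s))"
proof (induction n)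
  case (Suc n)
  show ?case
    unfolding fun_eq_iff nabla_funpow_Suc delta_funpow_Suc Suc
    by (simp add: algebra_simps sum_subtractf)
qed simp

text \<open>The iterated difference at \<open>t\<close> looks at \<open>t - 1\<close>,
  \<open>t - 2\<close> and so on, possibly below the interval; hence agreement is required on a set
  closed under stepping back.\<close>

lemma nabla_funpow_cong:
  assumes "\<And>t. t \<in> S \<Longrightarrow> f t = g t" and "\<And>t. t \<in> S \<Longrightarrow> t - 1 \<in> S" and "t \<in> S"
  shows "(nabla ^^ n) f t = (nabla ^^ n) g t"
  using assms(3)
proof (induction n arbitrary: t)
  case (Suc n)
  then show ?case
    unfolding nabla_funpow_Suc by (simp add: assms(2))
qed (simp add: assms(1))

lemma delta_funpow_cong:
  assumes "\<And>t. t \<in> S \<Longrightarrow> f t = g t" and "\<And>t. t \<in> S \<Longrightarrow> t + 1 \<in> S" and "t \<in> S"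
  shows "(delta ^^ n) f t = (delta ^^ n) g t"
  using assms(3)
proof (induction n arbitrary: t)
  case (Suc n)
  then show ?case
    unfolding delta_funpow_Suc by (simp add: assms(2))
qed (simp add: assms(1))

lemma Ints_diff_trans: "(x::real) - y \<in> \<int> \<Longrightarrow> y - z \<in> \<int> \<Longrightarrow> x - z \<in> \<int>"
  using Ints_add[of "x - y" "y - z"] by simp

lemma unit_steps_right:
  assumes "t - (a + 1) \<in> \<int>" "a + 1 \<le> t"
  shows "unit_steps t (b - 1) = {s \<in> unit_steps (a + 1) (b - 1). t \<le> s}"
proof -
  have "s - t \<in> \<int> \<longleftrightarrow> s - (a + 1) \<in> \<int>" for s
    using Ints_diff_trans[of s t "a + 1"] Ints_diff_trans[of s "a + 1" t] assms(1)
      Ints_minus[OF assms(1)] by auto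
  then show ?thesis
    using assms(2) by (auto simp: unit_steps_def)
qed

lemma nabla_left_eq_sum:
  assumes "t \<in> unit_steps (a + 1) (b - 1)"
  shows "nabla_left a \<mu> x t = (\<Sum>s\<in>unit_steps (a + 1) (b - 1). diff_kernel \<mu> (t - s) * x s)"
proof -
  let ?I = "unit_steps (a + 1) (b - 1)"
  \<comment> \<open>\<open>?S\<close> continues below \<open>a + 1\<close>, where the original sum
    is empty and the kernel vanishes. The bound \<open>t \<le> b - 1\<close> keeps all of
    \<open>unit_steps (a + 1) t\<close> inside \<open>?I\<close>.\<close>
  let ?S = "{t. t - (a + 1) \<in> \<int> \<and> t \<le> b - 1}"
  have "(nabla ^^ frac_n \<mu>)
       (\<lambda>t. \<Sum>s\<in>unit_steps (a + 1) t.
              complex_of_real (rising (t - rho s) (real (frac_n \<mu>) - \<mu> - 1)) * x s) t =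
     (nabla ^^ frac_n \<mu>) (\<lambda>t. \<Sum>s\<in>?I. frac_kernel \<mu> (t - s) * x s) t"
  proof (rule nabla_funpow_cong[where S = ?S])
    fix t assume t: "t \<in> ?S"
    have eq: "unit_steps (a + 1) t = {s \<in> ?I. s \<le> t}"
      using t by (auto simp: unit_steps_def)
    show "(\<Sum>s\<in>unit_steps (a + 1) t.
        complex_of_real (rising (t - rho s) (real (frac_n \<mu>) - \<mu> - 1)) * x s) =
      (\<Sum>s\<in>?I. frac_kernel \<mu> (t - s) * x s)"
      unfolding eq by (rule sum.mono_neutral_cong_left)
        (auto simp: finite_unit_steps frac_kernel_def rho_def algebra_simps)
    show "t - 1 \<in> ?S"
      using t Ints_diff[of "t - (a + 1)" 1] by (simp add: algebra_simps)
  qed (use assms in \<open>auto simp: unit_steps_def\<close>)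
  then show ?thesis
    by (simp add: nabla_left_def nabla_funpow_convolution diff_kernel_def sum_distrib_left mult.assoc)
qed

lemma nabla_right_eq_sum:
  assumes "t \<in> unit_steps (a + 1) (b - 1)"
  shows "nabla_right b \<mu> x t = (\<Sum>s\<in>unit_steps (a + 1) (b - 1). diff_kernel \<mu> (s - t) * x s)"
proof -
  let ?I = "unit_steps (a + 1) (b - 1)"
  \<comment> \<open>The mirror image, unbounded above. Integrality of \<open>t - (a + 1)\<close>
    puts \<open>unit_steps t (b - 1)\<close>, which starts at \<open>t\<close>, on the same lattice
    as \<open>?I\<close>.\<close>
  let ?S = "{t. t - (a + 1) \<in> \<int> \<and> a + 1 \<le> t}"
  have "(delta ^^ frac_n \<mu>)
       (\<lambda>t. \<Sum>s\<in>unit_steps t (b - 1).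
              complex_of_real (rising (s - rho t) (real (frac_n \<mu>) - \<mu> - 1)) * x s) t =
     (delta ^^ frac_n \<mu>) (\<lambda>t. \<Sum>s\<in>?I. frac_kernel \<mu> (s - t) * x s) t"
  proof (rule delta_funpow_cong[where S = ?S])
    fix t assume t: "t \<in> ?S"
    have eq: "unit_steps t (b - 1) = {s \<in> ?I. t \<le> s}"
      using t by (intro unit_steps_right) auto
    show "(\<Sum>s\<in>unit_steps t (b - 1).
        complex_of_real (rising (s - rho t) (real (frac_n \<mu>) - \<mu> - 1)) * x s) =
      (\<Sum>s\<in>?I. frac_kernel \<mu> (s - t) * x s)"
      unfolding eq by (rule sum.mono_neutral_cong_left)
        (auto simp: finite_unit_steps frac_kernel_def rho_def algebra_simps)
    show "t + 1 \<in> ?S"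
      using t Ints_add[of "t - (a + 1)" 1] by (simp add: algebra_simps)
  qed (use assms in \<open>auto simp: unit_steps_def\<close>)
  \<comment> \<open>One sign comes from the definition of \<open>nabla_right\<close>, the other from
    turning \<open>delta\<close> into \<open>nabla\<close>.\<close>
  moreover have "(-1::complex) ^ n * ((-1) ^ n * z) = z" for n z
    by (simp flip: mult.assoc power_mult_distrib)
  ultimately show ?thesis
    by (simp add: nabla_right_def delta_funpow_convolution diff_kernel_def sum_distrib_left mult.assoc
        flip: sum_divide_distrib)
qed

text \<open>Summation by parts, here just an exchange of two finite sums; conjugation passes through
  the kernel because it is real.\<close>

lemma sum_cnj_nabla_left:
  fixes a b :: real
  defines "I \<equiv> unit_steps (a + 1) (b - 1)"
  shows "(\<Sum>t\<in>I. cnj (x t) * nabla_left a \<mu> y t) = (\<Sum>s\<in>I. cnj (nabla_right b \<mu> x s) * y s)"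
proof -
  have K: "cnj (diff_kernel \<mu> d) = diff_kernel \<mu> d" for d
    using diff_kernel_real Reals_cnj_iff by blast
  have "(\<Sum>t\<in>I. cnj (x t) * nabla_left a \<mu> y t) =
      (\<Sum>t\<in>I. \<Sum>s\<in>I. cnj (x t) * (diff_kernel \<mu> (t - s) * y s))"
    unfolding I_def by (intro sum.cong) (simp_all add: nabla_left_eq_sum sum_distrib_left)
  also have "\<dots> = (\<Sum>s\<in>I. \<Sum>t\<in>I. cnj (x t) * (diff_kernel \<mu> (t - s) * y s))"
    by (rule sum.swap)
  also have "\<dots> = (\<Sum>s\<in>I. cnj (nabla_right b \<mu> x s) * y s)"
    unfolding I_def by (intro sum.cong) (simp_all add: nabla_right_eq_sum sum_distrib_left
        sum_distrib_right K mult_ac)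
  finally show ?thesis .
qed

text \<open>The product is \<open>c\<close> times the squared modulus of \<open>z\<close>.\<close>

lemma cnj_mult_of_real_mult_self_real: "cnj z * (complex_of_real c * z) \<in> \<real>"
  by (simp add: complex_is_Real_iff algebra_simps)

theorem theorem11:
  fixes \<mu> a b :: real
    and p q r :: "real \<Rightarrow> real"
    and lam :: complex
  assumes "\<mu> > 0"
    and "b - a \<in> \<int>"
    and "b - a \<ge> 2"
    and "\<And>t. t \<in> unit_steps (a + 1) (b - 1) \<Longrightarrow> p t > 0"
    and "\<And>t. t \<in> unit_steps (a + 1) (b - 1) \<Longrightarrow> r t > 0"
    and "fSL_eigenvalue \<mu> a b p q r lam"
  shows "lam \<in> \<real>"
proof -
  define I where "I = unit_steps (a + 1) (b - 1)"
  obtain x t0 where t0: "t0 \<in> I" "x t0 \<noteq> 0"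
    and eq: "\<And>t. t \<in> I \<Longrightarrow>
      nabla_left a \<mu> (\<lambda>\<tau>. complex_of_real (p \<tau>) * nabla_right b \<mu> x \<tau>) t
        + complex_of_real (q t) * x t = lam * complex_of_real (r t) * x t"
    using assms(6) unfolding fSL_eigenvalue_def I_def by blast
  define R where "R = (\<Sum>t\<in>I. r t * (cmod (x t))\<^sup>2)"
  have r_pos: "r t > 0" if "t \<in> I" for t
    using assms(5) that by (simp add: I_def)
  have "R > 0"
    unfolding R_def
    by (rule sum_pos2[OF _ t0(1)]) (use t0 r_pos in \<open>auto simp: I_def finite_unit_steps less_imp_le\<close>)
  have "lam * complex_of_real R = (\<Sum>t\<in>I. cnj (x t) * (lam * complex_of_real (r t) * x t))"
    unfolding R_def of_real_sum sum_distrib_left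
    by (intro sum.cong) (simp_all add: complex_norm_square mult_ac del: of_real_power)
  also have "\<dots> = (\<Sum>t\<in>I. cnj (x t) *
        nabla_left a \<mu> (\<lambda>\<tau>. complex_of_real (p \<tau>) * nabla_right b \<mu> x \<tau>) t) +
      (\<Sum>t\<in>I. cnj (x t) * (complex_of_real (q t) * x t))"
    by (simp add: ring_distribs flip: eq sum.distrib)
  \<comment> \<open>Summation by parts with \<open>y\<close> equal to \<open>p\<close> times the
    right difference of \<open>x\<close>, so that the right difference meets its own
    conjugate.\<close>
  also have "\<dots> = (\<Sum>s\<in>I. cnj (nabla_right b \<mu> x s) * (complex_of_real (p s) * nabla_right b \<mu> x s)) +
      (\<Sum>t\<in>I. cnj (x t) * (complex_of_real (q t) * x t))"
    by (simp add: I_def sum_cnj_nabla_left)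
  also have "\<dots> \<in> \<real>"
    by (intro Reals_add sum_in_Reals cnj_mult_of_real_mult_self_real)
  finally have "lam * complex_of_real R / complex_of_real R \<in> \<real>"
    by (intro Reals_divide) auto
  then show ?thesis
    using \<open>R > 0\<close> by simp
qed

end
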